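(* For any lattice $L$, the following statements are equivalent: (i) $L$ has a complete lattice embedding into some complete, lower continuous, join-semidistributive lattice. (ii) $L$ has a meet-complete lattice embedding into some complete, lower continuous, join-semidistributive lattice. (iii) $L$ is dually $*$-distributive. (iv) $L$ is dually zipper distributive and lower continuous.
   Context: A map $f\colon K\to L$ between posets is meet-complete if $x=\bigwedge_{i\in I}x_i$ in $K$ implies $f(x)=\bigwedge_{i\in I}f(x_i)$ in $L$, for every $x\in K$ and every family $(x_i)_{i\in I}$ of elements of $K$; join-complete is defined dually; $f$ is complete if it is both meet-complete and join-complete. A lattice $L$ is lower continuous if $a\vee\bigwedge X=\bigwedge\{a\vee x\mid x\in X\}$ for every $a\in L$ and every downward directed $X\subseteq L$ such that $\bigwedge X$ exists. A lattice is join-semidistributive if $x\vee y=x\vee z$ implies $x\vee y=x\vee(y\wedge z)$. For a lattice $L$, let $L\cup\{1\}$ be $L$ with a new largest element $1$ added. For $a\in L$ and a finite sequence $\boldsymbol{s}$ of elements of $L$, define $a*\boldsymbol{s}\in L\cup\{1\}$ inductively by $a*\varnothing=1$ and $a*(\boldsymbol{s}^\frown\langle b\rangle)=a\vee(b\wedge(a*\boldsymbol{s}))$. For $B\subseteq L$ let $a*B$ be the set of all $a*\boldsymbol{s}$, for $\boldsymbol{s}$ a finite sequence of elements of $B$. $L$ is dually $*$-distributive if for all $a\in L$ and $B\subseteq L$ such that $\bigwedge B$ exists in $L$, the meet $\bigwedge(a*B)$ (greatest element of $L$ below all elements of $a*B$) exists and $\bigwedge(a*B)=a\vee\bigwedge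 B$. $L$ is dually zipper distributive if this holds for all $B$ with at most two elements. *)

theory Defs
  imports "HOL-Algebra.Complete_Lattice"
begin

text \<open>
  Meets and joins that need not exist are handled relationally, by \<^term>\<open>is_glb L m X\<close> and
  \<^term>\<open>is_lub L m X\<close> (``the meet/join of \<open>X\<close> exists in \<open>L\<close> and equals \<open>m\<close>''), since the operators
  \<open>\<Sqinter>\<close> and \<open>\<Squnion>\<close> return an unspecified value when there is none.
\<close>

section \<open>Complete maps and embeddings\<close>

text \<open>
  A family is represented by its range, since its meet or join depends on nothing else.
  The empty family is included.
\<close>

definition meet_complete :: "('a, 'c) gorder_scheme \<Rightarrow> ('b, 'd) gorder_scheme \<Rightarrow> ('a \<Rightarrow> 'b) \<Rightarrow> bool"
  where "meet_complete K L f \<longleftrightarrow>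
    f \<in> carrier K \<rightarrow> carrier L \<and>
    (\<forall>x X. X \<subseteq> carrier K \<longrightarrow> is_glb K x X \<longrightarrow> is_glb L (f x) (f ` X))"

definition join_complete :: "('a, 'c) gorder_scheme \<Rightarrow> ('b, 'd) gorder_scheme \<Rightarrow> ('a \<Rightarrow> 'b) \<Rightarrow> bool"
  where "join_complete K L f \<longleftrightarrow>
    f \<in> carrier K \<rightarrow> carrier L \<and>
    (\<forall>x X. X \<subseteq> carrier K \<longrightarrow> is_lub K x X \<longrightarrow> is_lub L (f x) (f ` X))"

definition complete_map :: "('a, 'c) gorder_scheme \<Rightarrow> ('b, 'd) gorder_scheme \<Rightarrow> ('a \<Rightarrow> 'b) \<Rightarrow> bool"
  where "complete_map K L f \<longleftrightarrow> meet_complete K L f \<and> join_complete K L f"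

definition lattice_embedding :: "('a, 'c) gorder_scheme \<Rightarrow> ('b, 'd) gorder_scheme \<Rightarrow> ('a \<Rightarrow> 'b) \<Rightarrow> bool"
  where "lattice_embedding K L f \<longleftrightarrow>
    f \<in> carrier K \<rightarrow> carrier L \<and> inj_on f (carrier K) \<and> join_pres K L f \<and> meet_pres K L f"

section \<open>Lower continuity and join-semidistributivity\<close>

definition downward_directed :: "('a, 'c) gorder_scheme \<Rightarrow> 'a set \<Rightarrow> bool"
  where "downward_directed L X \<longleftrightarrow>
    X \<noteq> {} \<and> (\<forall>x\<in>X. \<forall>y\<in>X. \<exists>z\<in>X. z \<sqsubseteq>\<^bsub>L\<^esub> x \<and> z \<sqsubseteq>\<^bsub>L\<^esub> y)"

definition lower_continuous :: "('a, 'c) gorder_scheme \<Rightarrow> bool"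
  where "lower_continuous L \<longleftrightarrow>
    (\<forall>a\<in>carrier L. \<forall>X m. X \<subseteq> carrier L \<longrightarrow> downward_directed L X \<longrightarrow> is_glb L m X \<longrightarrow>
      is_glb L (a \<squnion>\<^bsub>L\<^esub> m) ((\<lambda>x. a \<squnion>\<^bsub>L\<^esub> x) ` X))"

definition join_semidistributive :: "('a, 'c) gorder_scheme \<Rightarrow> bool"
  where "join_semidistributive L \<longleftrightarrow>
    (\<forall>x\<in>carrier L. \<forall>y\<in>carrier L. \<forall>z\<in>carrier L.
      x \<squnion>\<^bsub>L\<^esub> y = x \<squnion>\<^bsub>L\<^esub> z \<longrightarrow> x \<squnion>\<^bsub>L\<^esub> y = x \<squnion>\<^bsub>L\<^esub> (y \<sqinter>\<^bsub>L\<^esub> z))"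

section \<open>The dual star operation\<close>

text \<open>
  The lattice \<open>L \<union> {1}\<close>: \<open>None\<close> is the new largest element, added even if \<open>L\<close> already has one.
\<close>

definition add_top :: "('a, 'c) gorder_scheme \<Rightarrow> 'a option gorder"
  where "add_top L =
    \<lparr> carrier = insert None (Some ` carrier L),
      eq = (=),
      le = (\<lambda>u v. case v of None \<Rightarrow> True
                    | Some y \<Rightarrow> (case u of None \<Rightarrow> False | Some x \<Rightarrow> x \<sqsubseteq>\<^bsub>L\<^esub> y)) \<rparr>"

text \<open>The left fold realises the recursion on the last entry of the sequence; see
  \<open>star_op_snoc\<close> below.\<close>

definition star_op :: "('a, 'c) gorder_scheme \<Rightarrow> 'a \<Rightarrow> 'a list \<Rightarrow> 'a option"
  where "star_op L a s =
    foldl (\<lambda>u b. Some a \<squnion>\<^bsub>add_top L\<^esub> (Some b \<sqinter>\<^bsub>add_top L\<^esub> u)) None s"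

lemma star_op_Nil: "star_op L a [] = None"
  by (simp add: star_op_def)

lemma star_op_snoc:
  "star_op L a (s @ [b]) = Some a \<squnion>\<^bsub>add_top L\<^esub> (Some b \<sqinter>\<^bsub>add_top L\<^esub> star_op L a s)"
  by (simp add: star_op_def)

definition star_set :: "('a, 'c) gorder_scheme \<Rightarrow> 'a \<Rightarrow> 'a set \<Rightarrow> 'a option set"
  where "star_set L a B = star_op L a ` lists B"

text \<open>
  The meet of a subset \<open>U\<close> of \<open>L \<union> {1}\<close> taken in \<open>L\<close>: the greatest element of \<open>L\<close> below all
  elements of \<open>U\<close>. It can differ from the meet in \<open>L \<union> {1}\<close> only for \<open>U \<subseteq> {1}\<close>.
\<close>

definition is_glb_in :: "('a, 'c) gorder_scheme \<Rightarrow> 'a \<Rightarrow> 'a option set \<Rightarrow> bool"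
  where "is_glb_in L m U \<longleftrightarrow>
    greatest L m {x \<in> carrier L. \<forall>u\<in>U. Some x \<sqsubseteq>\<^bsub>add_top L\<^esub> u}"

definition dual_star_law :: "('a, 'c) gorder_scheme \<Rightarrow> 'a \<Rightarrow> 'a set \<Rightarrow> bool"
  where "dual_star_law L a B \<longleftrightarrow>
    (\<forall>m. is_glb L m B \<longrightarrow> is_glb_in L (a \<squnion>\<^bsub>L\<^esub> m) (star_set L a B))"

definition dually_star_distributive :: "('a, 'c) gorder_scheme \<Rightarrow> bool"
  where "dually_star_distributive L \<longleftrightarrow>
    (\<forall>a\<in>carrier L. \<forall>B. B \<subseteq> carrier L \<longrightarrow> dual_star_law L a B)"

definition dually_zipper_distributive :: "('a, 'c) gorder_scheme \<Rightarrow> bool"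
  where "dually_zipper_distributive L \<longleftrightarrow>
    (\<forall>a\<in>carrier L. \<forall>B. B \<subseteq> carrier L \<and> finite B \<and> card B \<le> 2 \<longrightarrow> dual_star_law L a B)"

section \<open>Embeddability\<close>

text \<open>
  HOL cannot quantify over types inside a formula, so the type whose subsets carry the
  target lattice is a parameter.
\<close>

definition has_complete_embedding :: "'b itself \<Rightarrow> ('a, 'c) gorder_scheme \<Rightarrow> bool"
  where "has_complete_embedding (_ :: 'b itself) L \<longleftrightarrow>
    (\<exists>(K :: 'b gorder) f. complete_lattice K \<and> lower_continuous K \<and> join_semidistributive K \<and>
      lattice_embedding L K f \<and> complete_map L K f)"

definition has_meet_complete_embedding :: "'b itself \<Rightarrow> ('a, 'c) gorder_scheme \<Rightarrow> bool"
  where "has_meet_complete_embedding (_ :: 'b itself) L \<longleftrightarrow>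
    (\<exists>(K :: 'b gorder) f. complete_lattice K \<and> lower_continuous K \<and> join_semidistributive K \<and>
      lattice_embedding L K f \<and> meet_complete L K f)"

end

theory Submission
  imports Defs
begin

text \<open>
  For (iv) \<open>\<Longrightarrow>\<close> (i), embed \<open>L\<close> by principal filters into the lattice of its complete filters
  (upsets closed under all meets existing in \<open>L\<close>), ordered by reverse inclusion, where joins are
  intersections. Lower continuity of \<open>L\<close> makes the complete filter generated by a filter \<open>U\<close>
  consist of the meets of subsets of \<open>U\<close>, which yields lower continuity. If
  \<open>A \<inter> B = A \<inter> C\<close> and \<open>u \<in> A\<close> lies above \<open>b \<sqinter> c\<close> with \<open>b \<in> B\<close>, \<open>c \<in> C\<close>, then
  all elements of \<open>u * {b, c}\<close> other than \<open>1\<close> stay in \<open>A \<inter> B\<close>, so their meet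
  \<open>u \<squnion> (b \<sqinter> c) = u\<close> does too; this gives join-semidistributivity.

  For (ii) \<open>\<Longrightarrow>\<close> (iii), work in the target lattice and let \<open>c\<close> be the meet of \<open>a * B\<close>. The
  set \<open>a * B\<close> is downward directed, so lower continuity gives \<open>a \<squnion> (b \<sqinter> c) = c\<close>
  for each \<open>b \<in> B\<close>. By join-semidistributivity the elements \<open>d\<close> with
  \<open>a \<squnion> (d \<sqinter> c) = c\<close> form a filter, and lower continuity passes to its meet.
\<close>

section \<open>Meets and joins\<close>

text \<open>\<open>Lower\<close> tests only those elements of \<open>X\<close> that lie in the
  carrier, so \<open>X \<subseteq> carrier L\<close> is what turns it into the plain set of lower
  bounds.\<close>

lemma is_glb_iff:
  assumes "X \<subseteq> carrier L"
  shows "is_glb L m X \<longleftrightarrow> m \<in> carrier L \<and> (\<forall>x\<in>X. m \<sqsubseteq>\<^bsub>L\<^esub> x) \<and>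
    (\<forall>t\<in>carrier L. (\<forall>x\<in>X. t \<sqsubseteq>\<^bsub>L\<^esub> x) \<longrightarrow> t \<sqsubseteq>\<^bsub>L\<^esub> m)"
  using assms by (auto simp: greatest_def Lower_def subset_iff)

lemma is_lub_iff:
  assumes "X \<subseteq> carrier L"
  shows "is_lub L m X \<longleftrightarrow> m \<in> carrier L \<and> (\<forall>x\<in>X. x \<sqsubseteq>\<^bsub>L\<^esub> m) \<and>
    (\<forall>t\<in>carrier L. (\<forall>x\<in>X. x \<sqsubseteq>\<^bsub>L\<^esub> t) \<longrightarrow> m \<sqsubseteq>\<^bsub>L\<^esub> t)"
  using assms by (auto simp: least_def Upper_def subset_iff)

context lattice
begin

lemma join_mono:
  assumes "x \<sqsubseteq> x'" "y \<sqsubseteq> y'" "x \<in> carrier L" "x' \<in> carrier L" "y \<in> carrier L" "y' \<in> carrier L"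
  shows "x \<squnion> y \<sqsubseteq> x' \<squnion> y'"
  using assms by (meson join_closed join_le join_left join_right le_trans)

lemma meet_mono:
  assumes "x \<sqsubseteq> x'" "y \<sqsubseteq> y'" "x \<in> carrier L" "x' \<in> carrier L" "y \<in> carrier L" "y' \<in> carrier L"
  shows "x \<sqinter> y \<sqsubseteq> x' \<sqinter> y'"
  using assms by (meson meet_closed meet_le meet_left meet_right le_trans)

lemma join_unique:
  assumes "x \<in> carrier L" "y \<in> carrier L" "z \<in> carrier L" "x \<sqsubseteq> z" "y \<sqsubseteq> z"
    and "\<And>t. \<lbrakk>t \<in> carrier L; x \<sqsubseteq> t; y \<sqsubseteq> t\<rbrakk> \<Longrightarrow> z \<sqsubseteq> t"
  shows "x \<squnion> y = z"
  using assms by (meson join_closed join_le join_left join_right le_antisym)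

lemma meet_unique:
  assumes "x \<in> carrier L" "y \<in> carrier L" "z \<in> carrier L" "z \<sqsubseteq> x" "z \<sqsubseteq> y"
    and "\<And>t. \<lbrakk>t \<in> carrier L; t \<sqsubseteq> x; t \<sqsubseteq> y\<rbrakk> \<Longrightarrow> t \<sqsubseteq> z"
  shows "x \<sqinter> y = z"
  using assms by (meson le_antisym meet_closed meet_le meet_left meet_right)

lemma is_glb_pair:
  assumes "x \<in> carrier L" "y \<in> carrier L"
  shows "is_glb L (x \<sqinter> y) {x, y}"
  using inf_of_two_greatest[OF assms] by (simp add: meet_def)

end

section \<open>The elements of the dual star set\<close>

text \<open>These are the members of \<open>star_set\<close> other than the added top, so that later
  arguments stay inside \<open>L\<close>. Rule \<open>single\<close> is the one-term sequence: a
  meet with the added top leaves \<open>b\<close> unchanged.\<close>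

inductive_set star_elems :: "('a, 'c) gorder_scheme \<Rightarrow> 'a \<Rightarrow> 'a set \<Rightarrow> 'a set"
  for L (structure) and a B
  where
    single: "b \<in> B \<Longrightarrow> a \<squnion> b \<in> star_elems L a B"
  | step: "u \<in> star_elems L a B \<Longrightarrow> b \<in> B \<Longrightarrow> a \<squnion> (b \<sqinter> u) \<in> star_elems L a B"

context lattice
begin

section \<open>Computing with the added top\<close>

lemma add_top_simps [simp]:
  "carrier (add_top L) = insert None (Some ` carrier L)"
  "Some x \<sqsubseteq>\<^bsub>add_top L\<^esub> Some y \<longleftrightarrow> x \<sqsubseteq> y"
  "u \<sqsubseteq>\<^bsub>add_top L\<^esub> None"
  "\<not> None \<sqsubseteq>\<^bsub>add_top L\<^esub> Some y"
  by (auto simp: add_top_def)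

text \<open>Join and meet are chosen bounds, so \<open>star_op\<close> can be evaluated only once
  these bounds are known to exist and to be unique.\<close>

lemma lattice_add_top: "lattice (add_top L)"
proof
  show "(.=\<^bsub>add_top L\<^esub>) = (=)"
    by (simp add: add_top_def)
next
  fix x y assume "x \<in> carrier (add_top L)" "y \<in> carrier (add_top L)"
  then show "\<exists>s. is_lub (add_top L) s {x, y}"
    by (intro exI[of _ "case x of None \<Rightarrow> None | Some p \<Rightarrow>
          (case y of None \<Rightarrow> None | Some q \<Rightarrow> Some (p \<squnion> q))"])
      (auto simp: is_lub_iff join_left join_right join_le)
next
  fix x y assume "x \<in> carrier (add_top L)" "y \<in> carrier (add_top L)"
  then show "\<exists>s. is_glb (add_top L) s {x, y}"
    by (intro exI[of _ "case x of None \<Rightarrow> y | Some p \<Rightarrow>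
          (case y of None \<Rightarrow> x | Some q \<Rightarrow> Some (p \<sqinter> q))"])
      (auto simp: is_glb_iff meet_left meet_right meet_le)
qed (auto simp: add_top_def split: option.splits intro: le_trans)

lemma add_top_join:
  assumes "x \<in> carrier L" "y \<in> carrier L"
  shows "Some x \<squnion>\<^bsub>add_top L\<^esub> Some y = Some (x \<squnion> y)"
  using assms by (intro lattice.join_unique[OF lattice_add_top]) (auto simp: join_left join_right join_le)

lemma add_top_meet:
  assumes "x \<in> carrier L"
  shows "y \<in> carrier L \<Longrightarrow> Some x \<sqinter>\<^bsub>add_top L\<^esub> Some y = Some (x \<sqinter> y)"
    and "Some x \<sqinter>\<^bsub>add_top L\<^esub> None = Some x"
  using assms by (intro lattice.meet_unique[OF lattice_add_top]; auto simp: meet_left meet_right meet_le)+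

context
  fixes a B
  assumes a: "a \<in> carrier L" and B: "B \<subseteq> carrier L"
begin

lemma star_elems_closed: "u \<in> star_elems L a B \<Longrightarrow> u \<in> carrier L"
  by (induction rule: star_elems.induct) (use a B in auto)

lemma star_elems_above: "u \<in> star_elems L a B \<Longrightarrow> a \<sqsubseteq> u"
  by (erule star_elems.cases) (use a B star_elems_closed in \<open>auto intro!: join_left\<close>)

lemma star_op_in: "s \<in> lists B \<Longrightarrow> star_op L a s \<in> insert None (Some ` star_elems L a B)"
proof (induction s rule: rev_induct)
  case (snoc b s)
  then have b: "b \<in> B" and "star_op L a s \<in> insert None (Some ` star_elems L a B)"
    by auto
  with a B star_elems_closed show ?case
    by (auto simp: star_op_snoc add_top_meet add_top_join subset_iff intro: star_elems.intros)
qed (simp add: star_op_Nil)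

lemma star_set_eq: "star_set L a B = insert None (Some ` star_elems L a B)"
proof
  show "star_set L a B \<subseteq> insert None (Some ` star_elems L a B)"
    using star_op_in by (auto simp: star_set_def)
  have "Some u \<in> star_set L a B" if "u \<in> star_elems L a B" for u
    using that
  proof induction
    case (single b)
    then have "star_op L a [b] = Some (a \<squnion> b)"
      using a B star_op_snoc[of L a "[]" b] by (auto simp: star_op_Nil add_top_meet add_top_join)
    then show ?case
      using single by (force simp: star_set_def image_iff intro!: bexI[of _ "[b]"])
  next
    case (step u b)
    then obtain s where s: "s \<in> lists B" "star_op L a s = Some u"
      unfolding star_set_def by (metis imageE)
    have "star_op L a (s @ [b]) = Some (a \<squnion> (b \<sqinter> u))"
      using step s a B star_elems_closed
      by (auto simp: star_op_snoc add_top_meet add_top_join subset_iff)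
    then show ?case
      using step s by (force simp: star_set_def image_iff intro!: bexI[of _ "s @ [b]"])
  qed
  moreover have "None \<in> star_set L a B"
    unfolding star_set_def by (rule image_eqI[of _ _ "[]"]) (auto simp: star_op_Nil)
  ultimately show "insert None (Some ` star_elems L a B) \<subseteq> star_set L a B"
    by auto
qed

text \<open>The added top lies above everything and puts no condition on lower bounds.\<close>

lemma dual_star_law_iff:
  "dual_star_law L a B \<longleftrightarrow> (\<forall>m. is_glb L m B \<longrightarrow> is_glb L (a \<squnion> m) (star_elems L a B))"
proof -
  have "Lower L (star_elems L a B) = {x \<in> carrier L. \<forall>u\<in>star_set L a B. Some x \<sqsubseteq>\<^bsub>add_top L\<^esub> u}"
    using star_elems_closed by (auto simp: star_set_eq Lower_def)
  then show ?thesis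
    by (simp add: dual_star_law_def is_glb_in_def)
qed

text \<open>This is the half of the dual star law that holds in every lattice: \<open>m\<close> is
  below each \<open>b\<close>, and by induction below \<open>u\<close>.\<close>

lemma star_elems_lower:
  assumes "is_glb L m B" "u \<in> star_elems L a B"
  shows "a \<squnion> m \<sqsubseteq> u"
  using assms(2)
proof induction
  case (single b)
  with assms(1) a B show ?case
    by (auto simp: is_glb_iff intro!: join_mono)
next
  case (step u b)
  with assms(1) a B star_elems_closed have *: "m \<in> carrier L" "m \<sqsubseteq> b" "b \<in> carrier L" "u \<in> carrier L"
    by (auto simp: is_glb_iff)
  have "m \<sqsubseteq> u"
    using * a step by (meson join_closed join_right le_trans)
  with * a show ?case
    by (intro join_mono meet_le) auto
qed

text \<open>
  For sequences \<open>s\<close> and \<open>t\<close>, the element \<open>a * (s t)\<close> is below both \<open>a * s\<close> and \<open>a * t\<close>.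
\<close>

lemma star_elems_directed:
  assumes u: "u \<in> star_elems L a B" and "v \<in> star_elems L a B"
  shows "\<exists>w\<in>star_elems L a B. w \<sqsubseteq> u \<and> w \<sqsubseteq> v"
  using assms(2)
proof induction
  case (single b)
  with a B u star_elems_closed star_elems_above
  have *: "b \<in> carrier L" "u \<in> carrier L" "a \<sqsubseteq> u" by auto
  then have "a \<squnion> (b \<sqinter> u) \<sqsubseteq> u" "a \<squnion> (b \<sqinter> u) \<sqsubseteq> a \<squnion> b"
    using a by (auto intro!: join_le[of a u] meet_right join_mono meet_left)
  with single u show ?case
    by (blast intro: star_elems.step)
next
  case (step v b)
  then obtain w where w: "w \<in> star_elems L a B" "w \<sqsubseteq> u" "w \<sqsubseteq> v" by blast
  with a B u step star_elems_closed star_elems_above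
  have *: "b \<in> carrier L" "u \<in> carrier L" "v \<in> carrier L" "w \<in> carrier L" "a \<sqsubseteq> w" by auto
  \<comment> \<open>As \<open>a \<sqsubseteq> w\<close>, appending one more term to a sequence only
    moves its value down.\<close>
  then have "a \<squnion> (b \<sqinter> w) \<sqsubseteq> w"
    using a by (auto intro!: join_le[of a w] meet_right)
  then have "a \<squnion> (b \<sqinter> w) \<sqsubseteq> u"
    using * a w by (meson join_closed le_trans meet_closed)
  moreover have "a \<squnion> (b \<sqinter> w) \<sqsubseteq> a \<squnion> (b \<sqinter> v)"
    using * a w by (auto intro!: join_mono meet_mono)
  ultimately show ?case
    using w step by (blast intro: star_elems.step)
qed

end

section \<open>From dual star-distributivity to lower continuity\<close>

text \<open>For directed \<open>X\<close>, every star element lies above some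
  \<open>a \<squnion> x\<close>. Lower bounds of these joins are thus lower bounds of the star
  elements, whose meet is \<open>a \<squnion> m\<close>.\<close>

lemma star_imp_lower_continuous:
  assumes "dually_star_distributive L"
  shows "lower_continuous L"
  unfolding lower_continuous_def
proof (intro ballI allI impI)
  fix a X m
  assume a: "a \<in> carrier L" and X: "X \<subseteq> carrier L" and dir: "downward_directed L X" and m: "is_glb L m X"
  have glb: "is_glb L (a \<squnion> m) (star_elems L a X)"
    using assms a X m by (auto simp: dually_star_distributive_def dual_star_law_iff)
  have ex: "\<exists>x\<in>X. a \<squnion> x \<sqsubseteq> u" if "u \<in> star_elems L a X" for u
    using that
  proof induction
    case (single b)
    with a X show ?case by (auto intro!: bexI[of _ b])
  next
    case (step u b)
    then obtain x where x: "x \<in> X" "a \<squnion> x \<sqsubseteq> u" by blast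
    \<comment> \<open>A common lower bound \<open>z\<close> of \<open>b\<close> and \<open>x\<close>
      is also below \<open>b \<sqinter> u\<close>, since
      \<open>x \<sqsubseteq> a \<squnion> x \<sqsubseteq> u\<close>.\<close>
    with dir step obtain z where z: "z \<in> X" "z \<sqsubseteq> b" "z \<sqsubseteq> x"
      using x unfolding downward_directed_def by meson
    have c: "b \<in> carrier L" "x \<in> carrier L" "z \<in> carrier L" "u \<in> carrier L"
      using X x z step a star_elems_closed by auto
    have "z \<sqsubseteq> u"
      using c x z a by (meson join_closed join_right le_trans)
    with z c a have "a \<squnion> z \<sqsubseteq> a \<squnion> (b \<sqinter> u)"
      by (intro join_mono meet_le) auto
    with z show ?case by blast
  qed
  have "a \<squnion> m \<sqsubseteq> a \<squnion> x" if "x \<in> X" for x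
    using that m a X by (auto simp: is_glb_iff intro!: join_mono)
  moreover have "t \<sqsubseteq> a \<squnion> m" if t: "t \<in> carrier L" "\<forall>x\<in>X. t \<sqsubseteq> a \<squnion> x" for t
  proof -
    have "t \<sqsubseteq> u" if "u \<in> star_elems L a X" for u
      using ex[OF that] t X a star_elems_closed[OF a X that]
      by (meson join_closed le_trans subset_iff)
    then show ?thesis
      using glb t a X star_elems_closed by (subst (asm) is_glb_iff) auto
  qed
  ultimately show "is_glb L (a \<squnion> m) ((\<squnion>) a ` X)"
    using a X m by (subst is_glb_iff) (auto simp: is_glb_iff)
qed

end

lemma star_imp_zipper: "dually_star_distributive L \<Longrightarrow> dually_zipper_distributive L"
  by (auto simp: dually_star_distributive_def dually_zipper_distributive_def)

section \<open>Sublattices are dually star-distributive\<close>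

text \<open>The star elements are not known to have a meet in \<open>L\<close>, so their images are
  met in \<open>K\<close>, giving \<open>c\<close>. The goal is that \<open>c\<close> is below the
  join of \<open>f a\<close> and \<open>f m\<close>; since \<open>f\<close> reflects the order, this
  bound pulls back to \<open>L\<close>.\<close>

lemma meet_complete_embedding_imp_star:
  fixes L :: "('a, 'c) gorder_scheme" and K :: "('b, 'd) gorder_scheme"
  assumes "lattice L" and "complete_lattice K" and lc: "lower_continuous K"
    and jsd: "join_semidistributive K"
    and emb: "lattice_embedding L K f" and mc: "meet_complete L K f"
  shows "dually_star_distributive L"
proof -
  interpret L: lattice L by fact
  interpret K: complete_lattice K by fact
  have fc: "f x \<in> carrier K" if "x \<in> carrier L" for x
    using emb that by (auto simp: lattice_embedding_def)
  have fj: "f (x \<squnion>\<^bsub>L\<^esub> y) = f x \<squnion>\<^bsub>K\<^esub> f y" and fm: "f (x \<sqinter>\<^bsub>L\<^esub> y) = f x \<sqinter>\<^bsub>K\<^esub> f y"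
    if "x \<in> carrier L" "y \<in> carrier L" for x y
    using emb that by (auto simp: lattice_embedding_def join_pres_def meet_pres_def)
  \<comment> \<open>The order can be read off joins, which \<open>f\<close> preserves injectively.
    Despite its name, \<open>le_iff_meet\<close> is the characterisation by joins.\<close>
  have fle: "x \<sqsubseteq>\<^bsub>L\<^esub> y \<longleftrightarrow> f x \<sqsubseteq>\<^bsub>K\<^esub> f y" if "x \<in> carrier L" "y \<in> carrier L" for x y
  proof -
    have "x \<sqsubseteq>\<^bsub>L\<^esub> y \<longleftrightarrow> f (x \<squnion>\<^bsub>L\<^esub> y) = f y"
      using that emb by (auto simp: L.le_iff_meet lattice_embedding_def inj_on_def)
    then show ?thesis
      using that by (simp add: fj fc K.le_iff_meet)
  qed
  show ?thesis
    unfolding dually_star_distributive_def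
  proof (intro ballI allI impI)
    fix a B assume a: "a \<in> carrier L" and B: "B \<subseteq> carrier L"
    let ?S = "star_elems L a B"
    note Sc = L.star_elems_closed[OF a B]
    have "is_glb L (a \<squnion>\<^bsub>L\<^esub> m) ?S" if m: "is_glb L m B" for m
    proof -
      have mc': "m \<in> carrier L" using m by auto
      have fm': "is_glb K (f m) (f ` B)"
        using mc m B by (auto simp: meet_complete_def)
      define c where "c = \<Sqinter>\<^bsub>K\<^esub>(f ` ?S)"
      have fS: "f ` ?S \<subseteq> carrier K" using Sc fc by auto
      have cglb: "is_glb K c (f ` ?S)"
        unfolding c_def by (rule K.inf_glb[OF fS])
      then have cc: "c \<in> carrier K" by auto
      have clow: "c \<sqsubseteq>\<^bsub>K\<^esub> f u" if "u \<in> ?S" for u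
        using cglb fS that by (auto simp: is_glb_iff)
      have cgr: "t \<sqsubseteq>\<^bsub>K\<^esub> c" if "t \<in> carrier K" "\<And>u. u \<in> ?S \<Longrightarrow> t \<sqsubseteq>\<^bsub>K\<^esub> f u" for t
        using cglb fS that by (auto simp: is_glb_iff)
      have ac: "f a \<sqsubseteq>\<^bsub>K\<^esub> c"
        by (rule cgr) (use fc[OF a] fle[OF a Sc] L.star_elems_above[OF a B] in auto)
      have dle: "f a \<squnion>\<^bsub>K\<^esub> (d \<sqinter>\<^bsub>K\<^esub> c) \<sqsubseteq>\<^bsub>K\<^esub> c" if "d \<in> carrier K" for d
        using that cc ac fc[OF a] by (auto intro!: K.join_le K.meet_right)
      \<comment> \<open>By \<open>dle\<close>, membership in \<open>D\<close> amounts to the other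
        inequality, with \<open>c\<close> below the join.\<close>
      define D where "D = {d \<in> carrier K. f a \<squnion>\<^bsub>K\<^esub> (d \<sqinter>\<^bsub>K\<^esub> c) = c}"
      have Dc: "D \<subseteq> carrier K" by (auto simp: D_def)
      have fBD: "f ` B \<subseteq> D"
      proof safe
        fix b assume b: "b \<in> B"
        then have bc: "b \<in> carrier L" using B by auto
        have ne: "?S \<noteq> {}" using b by (auto intro: star_elems.single)
        \<comment> \<open>This set is directed because the star elements are, and its meet is that
          of \<open>f b\<close> with \<open>c\<close>. Lower continuity then brings the join with
          \<open>f a\<close> inside.\<close>
        let ?Y = "(\<lambda>u. f b \<sqinter>\<^bsub>K\<^esub> f u) ` ?S"
        have Yc: "?Y \<subseteq> carrier K" using Sc fc bc by auto
        have "downward_directed K ?Y"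
        proof -
          have "\<exists>w\<in>?S. f b \<sqinter>\<^bsub>K\<^esub> f w \<sqsubseteq>\<^bsub>K\<^esub> f b \<sqinter>\<^bsub>K\<^esub> f u \<and> f b \<sqinter>\<^bsub>K\<^esub> f w \<sqsubseteq>\<^bsub>K\<^esub> f b \<sqinter>\<^bsub>K\<^esub> f v"
            if uv: "u \<in> ?S" "v \<in> ?S" for u v
          proof -
            obtain w where w: "w \<in> ?S" "w \<sqsubseteq>\<^bsub>L\<^esub> u" "w \<sqsubseteq>\<^bsub>L\<^esub> v"
              using L.star_elems_directed[OF a B uv] by blast
            with uv fle Sc have "f w \<sqsubseteq>\<^bsub>K\<^esub> f u" "f w \<sqsubseteq>\<^bsub>K\<^esub> f v" by auto
            with w uv bc fc Sc show ?thesis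
              by (intro bexI[of _ w]) (auto intro!: K.meet_mono)
          qed
          then show ?thesis using ne by (auto simp: downward_directed_def)
        qed
        moreover have "is_glb K (f b \<sqinter>\<^bsub>K\<^esub> c) ?Y"
        proof (subst is_glb_iff[OF Yc], intro conjI ballI impI)
          show "f b \<sqinter>\<^bsub>K\<^esub> c \<in> carrier K" using fc[OF bc] cc by auto
          show "f b \<sqinter>\<^bsub>K\<^esub> c \<sqsubseteq>\<^bsub>K\<^esub> y" if "y \<in> ?Y" for y
            using that clow fc[OF bc] cc fc Sc by (auto intro!: K.meet_mono)
          fix t assume t: "t \<in> carrier K" "\<forall>y\<in>?Y. t \<sqsubseteq>\<^bsub>K\<^esub> y"
          have *: "t \<sqsubseteq>\<^bsub>K\<^esub> f b \<and> t \<sqsubseteq>\<^bsub>K\<^esub> f u" if u: "u \<in> ?S" for u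
          proof -
            have "t \<sqsubseteq>\<^bsub>K\<^esub> f b \<sqinter>\<^bsub>K\<^esub> f u" using t u by auto
            then show ?thesis
              using t fc[OF bc] fc[OF Sc[OF u]]
              by (metis K.le_trans K.meet_closed K.meet_left K.meet_right)
          qed
          have "t \<sqsubseteq>\<^bsub>K\<^esub> c" by (rule cgr) (use t * in auto)
          moreover have "t \<sqsubseteq>\<^bsub>K\<^esub> f b" using * ne by auto
          ultimately show "t \<sqsubseteq>\<^bsub>K\<^esub> f b \<sqinter>\<^bsub>K\<^esub> c"
            using t fc[OF bc] cc by (auto intro: K.meet_le)
        qed
        ultimately have g: "is_glb K (f a \<squnion>\<^bsub>K\<^esub> (f b \<sqinter>\<^bsub>K\<^esub> c)) ((\<squnion>\<^bsub>K\<^esub>) (f a) ` ?Y)"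
          using lc fc[OF a] Yc unfolding lower_continuous_def by blast
        have Zc: "(\<squnion>\<^bsub>K\<^esub>) (f a) ` ?Y \<subseteq> carrier K" using Yc fc[OF a] by auto
        \<comment> \<open>The right-hand side is the image of the star element obtained from
          \<open>u\<close> by one more step with \<open>b\<close>.\<close>
        have "c \<sqsubseteq>\<^bsub>K\<^esub> f a \<squnion>\<^bsub>K\<^esub> (f b \<sqinter>\<^bsub>K\<^esub> f u)" if "u \<in> ?S" for u
          using clow[OF star_elems.step[OF that b]] a bc Sc[OF that] by (simp add: fj fm)
        then have "c \<sqsubseteq>\<^bsub>K\<^esub> f a \<squnion>\<^bsub>K\<^esub> (f b \<sqinter>\<^bsub>K\<^esub> c)"
          using g cc unfolding is_glb_iff[OF Zc] by blast
        then show "f b \<in> D"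
          using dle[OF fc[OF bc]] fc a bc cc by (auto simp: D_def intro!: K.le_antisym)
      qed
      have Dup: "d' \<in> D" if "d \<in> D" "d \<sqsubseteq>\<^bsub>K\<^esub> d'" "d' \<in> carrier K" for d d'
      proof -
        have "c \<sqsubseteq>\<^bsub>K\<^esub> f a \<squnion>\<^bsub>K\<^esub> (d' \<sqinter>\<^bsub>K\<^esub> c)"
          using that cc fc[OF a] K.join_mono[of "f a" "f a" "d \<sqinter>\<^bsub>K\<^esub> c" "d' \<sqinter>\<^bsub>K\<^esub> c"]
          by (auto simp: D_def K.meet_mono)
        then show ?thesis
          using dle that cc fc[OF a] by (auto simp: D_def intro!: K.le_antisym)
      qed
      \<comment> \<open>This is the one place where join-semidistributivity enters: meeting
        \<open>d\<close> and \<open>e\<close> with \<open>c\<close> gives two elements whose joins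
        with \<open>f a\<close> are both \<open>c\<close>.\<close>
      have Dmeet: "d \<sqinter>\<^bsub>K\<^esub> e \<in> D" if d: "d \<in> D" and e: "e \<in> D" for d e
      proof -
        have dc: "d \<in> carrier K" "e \<in> carrier K" using d e Dc by auto
        have "f a \<squnion>\<^bsub>K\<^esub> (d \<sqinter>\<^bsub>K\<^esub> c) = f a \<squnion>\<^bsub>K\<^esub> (e \<sqinter>\<^bsub>K\<^esub> c)"
          using d e by (simp add: D_def)
        then have "f a \<squnion>\<^bsub>K\<^esub> (d \<sqinter>\<^bsub>K\<^esub> c) = f a \<squnion>\<^bsub>K\<^esub> ((d \<sqinter>\<^bsub>K\<^esub> c) \<sqinter>\<^bsub>K\<^esub> (e \<sqinter>\<^bsub>K\<^esub> c))"
          using jsd[unfolded join_semidistributive_def, rule_format, of "f a" "d \<sqinter>\<^bsub>K\<^esub> c" "e \<sqinter>\<^bsub>K\<^esub> c"]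
            fc[OF a] dc cc by simp
        moreover have "(d \<sqinter>\<^bsub>K\<^esub> c) \<sqinter>\<^bsub>K\<^esub> (e \<sqinter>\<^bsub>K\<^esub> c) \<sqsubseteq>\<^bsub>K\<^esub> (d \<sqinter>\<^bsub>K\<^esub> e) \<sqinter>\<^bsub>K\<^esub> c"
          using dc cc
          by (intro K.meet_le K.meet_mono K.meet_left K.le_trans[OF K.meet_left K.meet_right] K.meet_closed)
        ultimately have "c \<sqsubseteq>\<^bsub>K\<^esub> f a \<squnion>\<^bsub>K\<^esub> ((d \<sqinter>\<^bsub>K\<^esub> e) \<sqinter>\<^bsub>K\<^esub> c)"
          using d dc cc fc[OF a]
            K.join_mono[of "f a" "f a" "(d \<sqinter>\<^bsub>K\<^esub> c) \<sqinter>\<^bsub>K\<^esub> (e \<sqinter>\<^bsub>K\<^esub> c)" "(d \<sqinter>\<^bsub>K\<^esub> e) \<sqinter>\<^bsub>K\<^esub> c"]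
          by (auto simp: D_def)
        then show ?thesis
          using dle dc cc fc[OF a] by (auto simp: D_def intro!: K.le_antisym)
      qed
      have cD: "c \<sqsubseteq>\<^bsub>K\<^esub> f a \<squnion>\<^bsub>K\<^esub> f m"
      proof (cases "B = {}")
        \<comment> \<open>Meet-completeness covers the empty family, so \<open>f m\<close> is the
          greatest element of \<open>K\<close>.\<close>
        case True
        with fm' show ?thesis
          using cc fc[OF a] fc[OF mc']
          by (auto simp: greatest_def intro: K.le_trans[OF _ K.join_right])
      next
        case False
        let ?Y = "(\<lambda>d. d \<sqinter>\<^bsub>K\<^esub> c) ` D"
        have Yc: "?Y \<subseteq> carrier K" using Dc cc by auto
        have ne: "D \<noteq> {}" using False fBD by auto
        have "downward_directed K ?Y"
        proof -
          have "\<exists>w\<in>D. w \<sqinter>\<^bsub>K\<^esub> c \<sqsubseteq>\<^bsub>K\<^esub> d \<sqinter>\<^bsub>K\<^esub> c \<and> w \<sqinter>\<^bsub>K\<^esub> c \<sqsubseteq>\<^bsub>K\<^esub> e \<sqinter>\<^bsub>K\<^esub> c"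
            if de: "d \<in> D" "e \<in> D" for d e
            using subsetD[OF Dc de(1)] subsetD[OF Dc de(2)] cc
            by (intro bexI[OF _ Dmeet[OF de]] conjI K.meet_mono) (auto intro: K.meet_left K.meet_right)
          then show ?thesis using ne by (auto simp: downward_directed_def)
        qed
        moreover have glbY: "is_glb K (\<Sqinter>\<^bsub>K\<^esub>?Y) ?Y"
          by (rule K.inf_glb[OF Yc])
        ultimately have g: "is_glb K (f a \<squnion>\<^bsub>K\<^esub> \<Sqinter>\<^bsub>K\<^esub>?Y) ((\<squnion>\<^bsub>K\<^esub>) (f a) ` ?Y)"
          using lc fc[OF a] Yc unfolding lower_continuous_def by blast
        \<comment> \<open>All these joins equal \<open>c\<close> by the definition of
          \<open>D\<close>, so their meet is \<open>c\<close> as well.\<close>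
        have "(\<squnion>\<^bsub>K\<^esub>) (f a) ` ?Y = {c}"
          using ne by (force simp: D_def image_iff)
        with g cc have "c \<sqsubseteq>\<^bsub>K\<^esub> f a \<squnion>\<^bsub>K\<^esub> \<Sqinter>\<^bsub>K\<^esub>?Y"
          by (simp add: is_glb_iff)
        moreover have "\<Sqinter>\<^bsub>K\<^esub>?Y \<sqsubseteq>\<^bsub>K\<^esub> f m"
        proof -
          have "\<Sqinter>\<^bsub>K\<^esub>?Y \<sqsubseteq>\<^bsub>K\<^esub> f b" if b: "b \<in> B" for b
          proof -
            have "f b \<in> D" using fBD b by auto
            then have "\<Sqinter>\<^bsub>K\<^esub>?Y \<sqsubseteq>\<^bsub>K\<^esub> f b \<sqinter>\<^bsub>K\<^esub> c" "f b \<in> carrier K"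
              using K.inf_lower[OF Yc] Dc by auto
            then show ?thesis
              using cc Yc by (meson K.inf_closed K.le_trans K.meet_closed K.meet_left)
          qed
          moreover have "f ` B \<subseteq> carrier K" using B fc by auto
          ultimately show ?thesis
            using fm' K.inf_closed[OF Yc] by (auto simp: is_glb_iff)
        qed
        ultimately show ?thesis
          using cc fc[OF a] fc[OF mc'] Yc K.inf_closed[OF Yc]
          by (meson K.join_closed K.join_mono K.le_refl K.le_trans)
      qed
      show ?thesis
      proof (subst is_glb_iff)
        show "?S \<subseteq> carrier L" using Sc by auto
        have "t \<sqsubseteq>\<^bsub>L\<^esub> a \<squnion>\<^bsub>L\<^esub> m" if t: "t \<in> carrier L" "\<forall>u\<in>?S. t \<sqsubseteq>\<^bsub>L\<^esub> u" for t
        proof -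
          have "f t \<sqsubseteq>\<^bsub>K\<^esub> c" using t fle Sc by (auto intro!: cgr fc)
          then have "f t \<sqsubseteq>\<^bsub>K\<^esub> f a \<squnion>\<^bsub>K\<^esub> f m"
            using cD cc fc t a mc' by (meson K.join_closed K.le_trans)
          then show ?thesis using t a mc' by (simp add: fle fj)
        qed
        then show "a \<squnion>\<^bsub>L\<^esub> m \<in> carrier L \<and> (\<forall>x\<in>?S. a \<squnion>\<^bsub>L\<^esub> m \<sqsubseteq>\<^bsub>L\<^esub> x) \<and>
            (\<forall>t\<in>carrier L. (\<forall>x\<in>?S. t \<sqsubseteq>\<^bsub>L\<^esub> x) \<longrightarrow> t \<sqsubseteq>\<^bsub>L\<^esub> a \<squnion>\<^bsub>L\<^esub> m)"
          using a mc' L.star_elems_lower[OF a B m] by auto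
      qed
    qed
    then show "dual_star_law L a B"
      using L.dual_star_law_iff[OF a B] by blast
  qed
qed

section \<open>The lattice of complete filters\<close>

text \<open>The family \<open>X\<close> may be empty: a greatest element of \<open>L\<close> lies in
  every complete filter, and the empty set is a complete filter exactly when \<open>L\<close> has no
  greatest element.\<close>

definition complete_filter :: "('a, 'c) gorder_scheme \<Rightarrow> 'a set \<Rightarrow> bool"
  where "complete_filter L A \<longleftrightarrow> A \<subseteq> carrier L \<and>
    (\<forall>x\<in>A. \<forall>y\<in>carrier L. x \<sqsubseteq>\<^bsub>L\<^esub> y \<longrightarrow> y \<in> A) \<and>
    (\<forall>X m. X \<subseteq> A \<longrightarrow> is_glb L m X \<longrightarrow> m \<in> A)"

definition complete_filters :: "('a, 'c) gorder_scheme \<Rightarrow> 'a set gorder"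
  where "complete_filters L = \<lparr> carrier = Collect (complete_filter L), eq = (=), le = (\<lambda>A B. B \<subseteq> A) \<rparr>"

lemma complete_filters_simps [simp]:
  "carrier (complete_filters L) = Collect (complete_filter L)"
  "A \<sqsubseteq>\<^bsub>complete_filters L\<^esub> B \<longleftrightarrow> B \<subseteq> A"
  by (auto simp: complete_filters_def)

definition principal_filter :: "('a, 'c) gorder_scheme \<Rightarrow> 'a \<Rightarrow> 'a set"
  where "principal_filter L x = {y \<in> carrier L. x \<sqsubseteq>\<^bsub>L\<^esub> y}"

text \<open>An element that is the meet of some subset of \<open>U \<subseteq> carrier L\<close> is
  also the meet of all elements of \<open>U\<close> above it. The latter set is determined by
  \<open>z\<close>, and it is directed when nonempty if \<open>U\<close> is closed under binary
  meets.\<close>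

definition meet_closure :: "('a, 'c) gorder_scheme \<Rightarrow> 'a set \<Rightarrow> 'a set"
  where "meet_closure L U = {z \<in> carrier L. is_glb L z {u \<in> U. z \<sqsubseteq>\<^bsub>L\<^esub> u}}"

lemma complete_filter_subset: "complete_filter L A \<Longrightarrow> A \<subseteq> carrier L"
  by (simp add: complete_filter_def)

lemma complete_filter_up:
  "complete_filter L A \<Longrightarrow> x \<in> A \<Longrightarrow> x \<sqsubseteq>\<^bsub>L\<^esub> y \<Longrightarrow> y \<in> carrier L \<Longrightarrow> y \<in> A"
  by (auto simp: complete_filter_def)

lemma complete_filter_glb:
  "complete_filter L A \<Longrightarrow> X \<subseteq> A \<Longrightarrow> is_glb L m X \<Longrightarrow> m \<in> A"
  unfolding complete_filter_def by blast

text \<open>The factor \<open>carrier L\<close> handles the empty family, whose intersection would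
  be the whole type.\<close>

lemma complete_filter_Inter:
  assumes "\<And>A. A \<in> \<A> \<Longrightarrow> complete_filter L A"
  shows "complete_filter L (carrier L \<inter> \<Inter>\<A>)"
  unfolding complete_filter_def
proof (intro conjI ballI allI impI)
  fix X m assume X: "X \<subseteq> carrier L \<inter> \<Inter>\<A>" and m: "is_glb L m X"
  have "m \<in> A" if "A \<in> \<A>" for A
    using X that by (intro complete_filter_glb[OF assms[OF that] _ m]) auto
  then show "m \<in> carrier L \<inter> \<Inter>\<A>" using m by auto
qed (use complete_filter_up[OF assms] in auto)

lemma complete_filter_Int:
  assumes "complete_filter L A" "complete_filter L B"
  shows "complete_filter L (A \<inter> B)"
proof -
  have "A \<inter> B = carrier L \<inter> \<Inter>{A, B}"
    using complete_filter_subset[OF assms(1)] by auto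
  then show ?thesis
    using complete_filter_Inter[of "{A, B}" L] assms by auto
qed

lemma partial_order_complete_filters: "partial_order (complete_filters L)"
  by unfold_locales (auto simp: complete_filters_def)

lemma complete_lattice_complete_filters: "complete_lattice (complete_filters L)"
proof -
  interpret K: partial_order "complete_filters L"
    by (rule partial_order_complete_filters)
  show ?thesis
  proof
    fix \<A> assume AK: "\<A> \<subseteq> carrier (complete_filters L)"
    then have A: "\<And>A. A \<in> \<A> \<Longrightarrow> complete_filter L A" by auto
    show "\<exists>s. is_lub (complete_filters L) s \<A>"
      using A complete_filter_Inter[OF A] complete_filter_subset[of L]
      by (intro exI[of _ "carrier L \<inter> \<Inter>\<A>"]) (subst is_lub_iff; auto)
    \<comment> \<open>Under reverse inclusion, a meet is the least complete filter including the
      union.\<close>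
    let ?C = "{C. complete_filter L C \<and> \<Union>\<A> \<subseteq> C}"
    have C: "\<And>C. C \<in> ?C \<Longrightarrow> complete_filter L C" by auto
    have "is_glb (complete_filters L) (carrier L \<inter> \<Inter>?C) \<A>"
    proof (subst is_glb_iff[OF AK], intro conjI ballI impI)
      show "carrier L \<inter> \<Inter>?C \<in> carrier (complete_filters L)"
        using complete_filter_Inter[of ?C, OF C] by simp
      show "carrier L \<inter> \<Inter>?C \<sqsubseteq>\<^bsub>complete_filters L\<^esub> B" if "B \<in> \<A>" for B
        using that complete_filter_subset[OF A[OF that]] by auto
    qed auto
    then show "\<exists>s. is_glb (complete_filters L) s \<A>" ..
  qed
qed

lemma complete_filters_join:
  assumes "complete_filter L A" "complete_filter L B"
  shows "A \<squnion>\<^bsub>complete_filters L\<^esub> B = A \<inter> B"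
proof -
  interpret K: complete_lattice "complete_filters L"
    by (rule complete_lattice_complete_filters)
  show ?thesis
    using assms complete_filter_Int[OF assms] by (intro K.join_unique) auto
qed

context lattice
begin

lemma complete_filter_meet:
  "complete_filter L A \<Longrightarrow> x \<in> A \<Longrightarrow> y \<in> A \<Longrightarrow> x \<sqinter> y \<in> A"
  by (rule complete_filter_glb[of L A "{x, y}"])
    (simp_all add: is_glb_pair subsetD[OF complete_filter_subset])

lemma complete_filter_principal:
  assumes "x \<in> carrier L"
  shows "complete_filter L (principal_filter L x)"
proof -
  have "x \<sqsubseteq> m" if "X \<subseteq> principal_filter L x" "is_glb L m X" for X m
  proof -
    have "X \<subseteq> carrier L" using that by (auto simp: principal_filter_def)
    then show ?thesis using that assms by (auto simp: is_glb_iff principal_filter_def)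
  qed
  then show ?thesis
    using assms unfolding complete_filter_def principal_filter_def by (auto intro: le_trans)
qed

section \<open>The embedding by principal filters\<close>

lemma lattice_embedding_principal_filter:
  "lattice_embedding L (complete_filters L) (principal_filter L)"
proof -
  interpret K: complete_lattice "complete_filters L"
    by (rule complete_lattice_complete_filters)
  note pf = complete_filter_principal
  have inj: "inj_on (principal_filter L) (carrier L)"
  proof (rule inj_onI)
    fix x y assume xy: "x \<in> carrier L" "y \<in> carrier L" "principal_filter L x = principal_filter L y"
    then have "x \<in> principal_filter L y" "y \<in> principal_filter L x"
      by (auto simp: principal_filter_def)
    with xy show "x = y" by (auto simp: principal_filter_def)
  qed
  have j: "principal_filter L (x \<squnion> y) = principal_filter L x \<squnion>\<^bsub>complete_filters L\<^esub> principal_filter L y"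
    if "x \<in> carrier L" "y \<in> carrier L" for x y
    using that
    unfolding complete_filters_join[OF pf[OF that(1)] pf[OF that(2)]]
    by (auto simp: principal_filter_def
        intro: join_le le_trans[OF join_left] le_trans[OF join_right])
  have m: "principal_filter L (x \<sqinter> y) = principal_filter L x \<sqinter>\<^bsub>complete_filters L\<^esub> principal_filter L y"
    if "x \<in> carrier L" "y \<in> carrier L" for x y
  proof (rule K.meet_unique[symmetric])
    fix T assume T: "T \<in> carrier (complete_filters L)"
      "T \<sqsubseteq>\<^bsub>complete_filters L\<^esub> principal_filter L x" "T \<sqsubseteq>\<^bsub>complete_filters L\<^esub> principal_filter L y"
    then have "x \<in> T" "y \<in> T" using that by (auto simp: principal_filter_def)
    then have "x \<sqinter> y \<in> T" using T complete_filter_meet by simp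
    then show "T \<sqsubseteq>\<^bsub>complete_filters L\<^esub> principal_filter L (x \<sqinter> y)"
      using T complete_filter_up by (auto simp: principal_filter_def)
  next
    show "principal_filter L (x \<sqinter> y) \<sqsubseteq>\<^bsub>complete_filters L\<^esub> principal_filter L x"
      "principal_filter L (x \<sqinter> y) \<sqsubseteq>\<^bsub>complete_filters L\<^esub> principal_filter L y"
      using that by (auto simp: principal_filter_def
          intro: le_trans[OF meet_left] le_trans[OF meet_right])
  qed (use that in \<open>auto simp: pf\<close>)
  show ?thesis
    using inj j m pf lattice_axioms K.lattice_axioms
    by (auto simp: lattice_embedding_def join_pres_def meet_pres_def)
qed

text \<open>Meets are preserved because a complete filter containing \<open>X\<close> contains its
  meet. Joins are preserved because the common upper bounds of \<open>X\<close> form the principal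
  filter of its join.\<close>

lemma complete_map_principal_filter:
  "complete_map L (complete_filters L) (principal_filter L)"
proof -
  note pf = complete_filter_principal
  have im: "principal_filter L ` X \<subseteq> carrier (complete_filters L)" if "X \<subseteq> carrier L" for X
    using that pf by auto
  have "is_glb (complete_filters L) (principal_filter L x) (principal_filter L ` X)"
    if X: "X \<subseteq> carrier L" and x: "is_glb L x X" for x X
  proof -
    have xc: "x \<in> carrier L" and low: "\<And>y. y \<in> X \<Longrightarrow> x \<sqsubseteq> y"
      using x X by (auto simp: is_glb_iff)
    have "principal_filter L x \<subseteq> T"
      if T: "complete_filter L T" "\<forall>y\<in>X. principal_filter L y \<subseteq> T" for T
    proof -
      have "X \<subseteq> T" using T X by (force simp: principal_filter_def)
      then have "x \<in> T" using T x by (auto intro: complete_filter_glb)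
      then show ?thesis
        using T complete_filter_up by (auto simp: principal_filter_def)
    qed
    then show ?thesis
      using xc X low pf[OF xc]
      by (subst is_glb_iff[OF im[OF X]]) (auto simp: principal_filter_def intro: le_trans[OF low])
  qed
  moreover have "is_lub (complete_filters L) (principal_filter L x) (principal_filter L ` X)"
    if X: "X \<subseteq> carrier L" and x: "is_lub L x X" for x X
  proof -
    have xc: "x \<in> carrier L" and up: "\<And>y. y \<in> X \<Longrightarrow> y \<sqsubseteq> x"
      and lst: "\<And>t. t \<in> carrier L \<Longrightarrow> (\<And>y. y \<in> X \<Longrightarrow> y \<sqsubseteq> t) \<Longrightarrow> x \<sqsubseteq> t"
      using x X by (auto simp: is_lub_iff)
    have "T \<subseteq> principal_filter L x"
      if T: "complete_filter L T" "\<forall>y\<in>X. T \<subseteq> principal_filter L y" for T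
      using T complete_filter_subset[OF T(1)] by (auto simp: principal_filter_def intro!: lst)
    then show ?thesis
      using xc X up pf[OF xc]
      by (subst is_lub_iff[OF im[OF X]]) (auto simp: principal_filter_def intro: le_trans[OF up])
  qed
  ultimately show ?thesis
    using pf by (auto simp: complete_map_def meet_complete_def join_complete_def)
qed

section \<open>Lower continuity and join-semidistributivity of the complete filters\<close>

lemma subset_meet_closure: "U \<subseteq> carrier L \<Longrightarrow> U \<subseteq> meet_closure L U"
  by (auto simp: meet_closure_def subset_iff intro!: is_glb_iff[THEN iffD2])

text \<open>Lower continuity gives upward closure: if \<open>z \<sqsubseteq> x\<close>, joining
  \<open>x\<close> to the directed set of elements of \<open>U\<close> above \<open>z\<close> yields
  elements of \<open>U\<close> above \<open>x\<close> with meet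
  \<open>x \<squnion> z = x\<close>.\<close>

lemma complete_filter_meet_closure:
  assumes lc: "lower_continuous L" and U: "U \<subseteq> carrier L"
    and up: "\<And>x y. x \<in> U \<Longrightarrow> y \<in> carrier L \<Longrightarrow> x \<sqsubseteq> y \<Longrightarrow> y \<in> U"
    and meet: "\<And>x y. x \<in> U \<Longrightarrow> y \<in> U \<Longrightarrow> x \<sqinter> y \<in> U"
  shows "complete_filter L (meet_closure L U)"
proof -
  let ?Y = "\<lambda>z. {u \<in> U. z \<sqsubseteq> u}"
  have Yc: "?Y z \<subseteq> carrier L" for z using U by auto
  have "x \<in> meet_closure L U" if z: "z \<in> meet_closure L U" and x: "x \<in> carrier L" "z \<sqsubseteq> x" for z x
  proof (cases "?Y z = {}")
    \<comment> \<open>Here \<open>z\<close> is an empty meet, hence the greatest element of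
      \<open>L\<close>.\<close>
    case True
    have zc: "z \<in> carrier L" "is_glb L z (?Y z)" using z by (auto simp: meet_closure_def)
    then have "x \<sqsubseteq> z" using True x by (auto simp: greatest_def)
    then have "x = z" using x zc by auto
    with z show ?thesis by simp
  next
    case False
    have zc: "z \<in> carrier L" and glb: "is_glb L z (?Y z)" using z by (auto simp: meet_closure_def)
    have "downward_directed L (?Y z)"
      unfolding downward_directed_def
    proof (intro conjI ballI)
      fix u v assume uv: "u \<in> ?Y z" "v \<in> ?Y z"
      with U have "u \<in> carrier L" "v \<in> carrier L" by auto
      with uv zc meet show "\<exists>w\<in>?Y z. w \<sqsubseteq> u \<and> w \<sqsubseteq> v"
        by (intro bexI[of _ "u \<sqinter> v"]) (auto intro: meet_le meet_left meet_right)
    qed (rule False)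
    then have g: "is_glb L (x \<squnion> z) ((\<squnion>) x ` ?Y z)"
      using lc x Yc glb unfolding lower_continuous_def by blast
    have xz: "x \<squnion> z = x" using x zc by (metis join_comm le_iff_meet)
    have Zc: "(\<squnion>) x ` ?Y z \<subseteq> carrier L" using x U by auto
    have "x \<squnion> u \<in> ?Y x" if "u \<in> ?Y z" for u
      using that x U up[of u "x \<squnion> u"] by (auto simp: subset_iff intro: join_left join_right)
    then have "is_glb L x (?Y x)"
      using g x unfolding xz is_glb_iff[OF Zc] is_glb_iff[OF Yc] by auto
    then show ?thesis using x by (simp add: meet_closure_def)
  qed
  moreover have "m \<in> meet_closure L U" if X: "X \<subseteq> meet_closure L U" and m: "is_glb L m X" for X m
  proof -
    have Xc: "X \<subseteq> carrier L" using X by (auto simp: meet_closure_def)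
    have mc: "m \<in> carrier L" using m by auto
    \<comment> \<open>For \<open>x \<in> X\<close>, the elements of \<open>U\<close> above
      \<open>x\<close> are among those above \<open>m\<close>, so \<open>t\<close> is below their
      meet \<open>x\<close>.\<close>
    have "t \<sqsubseteq> m" if t: "t \<in> carrier L" "\<forall>u\<in>?Y m. t \<sqsubseteq> u" for t
    proof -
      have "t \<sqsubseteq> x" if x: "x \<in> X" for x
      proof -
        have "m \<sqsubseteq> x" using m x Xc by (auto simp: is_glb_iff)
        then have "?Y x \<subseteq> ?Y m" using x Xc mc U by (auto intro: le_trans)
        moreover have "is_glb L x (?Y x)" using x X by (auto simp: meet_closure_def)
        ultimately show ?thesis using t unfolding is_glb_iff[OF Yc] by blast
      qed
      then show ?thesis using m t Xc by (auto simp: is_glb_iff)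
    qed
    then show ?thesis
      using mc by (auto simp: meet_closure_def is_glb_iff[OF Yc])
  qed
  ultimately show ?thesis
    unfolding complete_filter_def meet_closure_def by blast
qed

text \<open>If \<open>z \<in> A\<close>, the elements of \<open>U\<close> above \<open>z\<close> lie
  in \<open>A\<close>, hence in \<open>T\<close>, and \<open>z\<close> is their meet. Inclusions of
  this kind can therefore be checked on \<open>U\<close> alone.\<close>

lemma complete_filter_meet_closure_Int:
  assumes "complete_filter L A" "complete_filter L T" "A \<inter> U \<subseteq> T"
    and U: "U \<subseteq> carrier L"
  shows "A \<inter> meet_closure L U \<subseteq> T"
proof
  fix z assume z: "z \<in> A \<inter> meet_closure L U"
  then have g: "is_glb L z {u \<in> U. z \<sqsubseteq> u}" by (auto simp: meet_closure_def)
  have "{u \<in> U. z \<sqsubseteq> u} \<subseteq> T"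
    using z assms complete_filter_up[OF assms(1)] by blast
  then show "z \<in> T" using g complete_filter_glb[OF assms(2)] by blast
qed

text \<open>Directedness makes the union of the family a filter, so its meet closure is a complete
  filter that includes \<open>M\<close>. A complete filter including every
  \<open>A \<inter> B\<close> then includes \<open>A \<inter> M\<close>.\<close>

lemma lower_continuous_complete_filters:
  assumes lc: "lower_continuous L"
  shows "lower_continuous (complete_filters L)"
  unfolding lower_continuous_def
proof (intro ballI allI impI)
  let ?K = "complete_filters L"
  fix A \<X> M
  assume A: "A \<in> carrier ?K" and X: "\<X> \<subseteq> carrier ?K" and dir: "downward_directed ?K \<X>"
    and M: "is_glb ?K M \<X>"
  have cf: "complete_filter L A" "complete_filter L M" "\<And>B. B \<in> \<X> \<Longrightarrow> complete_filter L B"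
    using A X greatest_closed[OF M] by auto
  have sub: "\<And>B. B \<in> \<X> \<Longrightarrow> B \<subseteq> M" using M unfolding is_glb_iff[OF X] by auto
  have U: "\<Union>\<X> \<subseteq> carrier L" using cf complete_filter_subset by blast
  have "complete_filter L (meet_closure L (\<Union>\<X>))"
  proof (rule complete_filter_meet_closure[OF lc U])
    show "y \<in> \<Union>\<X>" if "x \<in> \<Union>\<X>" "y \<in> carrier L" "x \<sqsubseteq> y" for x y
      using that complete_filter_up[OF cf(3)] by auto
    show "x \<sqinter> y \<in> \<Union>\<X>" if xy: "x \<in> \<Union>\<X>" "y \<in> \<Union>\<X>" for x y
    proof -
      obtain B C where "B \<in> \<X>" "C \<in> \<X>" "x \<in> B" "y \<in> C"
        using xy by auto
      moreover from this obtain D where "D \<in> \<X>" "B \<subseteq> D" "C \<subseteq> D"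
        using dir unfolding downward_directed_def complete_filters_simps by meson
      ultimately show ?thesis using complete_filter_meet[OF cf(3)] by blast
    qed
  qed
  then have Mcl: "M \<subseteq> meet_closure L (\<Union>\<X>)"
    using M subset_meet_closure[OF U] unfolding is_glb_iff[OF X] by (simp add: Sup_le_iff)
  have "A \<inter> M \<subseteq> T" if T: "complete_filter L T" "\<forall>B\<in>\<X>. A \<inter> B \<subseteq> T" for T
    using complete_filter_meet_closure_Int[OF cf(1) T(1) _ U] Mcl T(2) by blast
  moreover have "(\<lambda>B. A \<squnion>\<^bsub>?K\<^esub> B) ` \<X> = (\<inter>) A ` \<X>"
    using cf by (auto simp: complete_filters_join image_iff)
  ultimately show "is_glb ?K (A \<squnion>\<^bsub>?K\<^esub> M) ((\<squnion>\<^bsub>?K\<^esub>) A ` \<X>)"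
    using cf by (subst is_glb_iff) (auto simp: complete_filters_join complete_filter_Int dest: subsetD[OF sub])
qed

lemma join_semidistributive_complete_filters:
  assumes lc: "lower_continuous L" and zip: "dually_zipper_distributive L"
  shows "join_semidistributive (complete_filters L)"
  unfolding join_semidistributive_def
proof (intro ballI impI)
  let ?K = "complete_filters L"
  interpret K: complete_lattice ?K
    by (rule complete_lattice_complete_filters)
  fix A B C assume ABC: "A \<in> carrier ?K" "B \<in> carrier ?K" "C \<in> carrier ?K"
    and "A \<squnion>\<^bsub>?K\<^esub> B = A \<squnion>\<^bsub>?K\<^esub> C"
  then have cf: "complete_filter L A" "complete_filter L B" "complete_filter L C"
    and eq: "A \<inter> B = A \<inter> C"
    by (auto simp: complete_filters_join)
  define M where "M = B \<sqinter>\<^bsub>?K\<^esub> C"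
  have M: "complete_filter L M" "B \<subseteq> M" "C \<subseteq> M"
    using ABC K.meet_left[of B C] K.meet_right[of B C] K.meet_closed[of B C]
    by (auto simp: M_def)
  have Mleast: "M \<subseteq> T" if "complete_filter L T" "B \<subseteq> T" "C \<subseteq> T" for T
    using K.meet_le[of T B C] ABC that by (auto simp: M_def)
  have AB: "complete_filter L (A \<inter> B)"
    using cf by (simp add: complete_filter_Int)
  have "A \<inter> M \<subseteq> A \<inter> B"
  proof (cases "B = {} \<or> C = {}")
    case True
    \<comment> \<open>If one of the two is empty, the other already includes their union.\<close>
    then have "M \<subseteq> B \<or> M \<subseteq> C" using Mleast cf by auto
    with eq show ?thesis by auto
  next
    case False
    \<comment> \<open>This is the filter generated by the union of \<open>B\<close> and
      \<open>C\<close>; both being nonempty is what puts them inside it.\<close>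
    define U where "U = {u \<in> carrier L. \<exists>b\<in>B. \<exists>c\<in>C. b \<sqinter> c \<sqsubseteq> u}"
    have U: "U \<subseteq> carrier L" by (auto simp: U_def)
    note BC = complete_filter_subset[OF cf(2)] complete_filter_subset[OF cf(3)]
    have "complete_filter L (meet_closure L U)"
    proof (rule complete_filter_meet_closure[OF lc U])
      fix x y assume xy: "x \<in> U" "y \<in> carrier L" "x \<sqsubseteq> y"
      then obtain b c where "x \<in> carrier L" "b \<in> B" "c \<in> C" "b \<sqinter> c \<sqsubseteq> x"
        by (auto simp: U_def)
      moreover from this have "b \<sqinter> c \<sqsubseteq> y"
        using xy BC by (meson le_trans meet_closed subset_iff)
      ultimately show "y \<in> U" using xy by (auto simp: U_def)
    next
      fix x y assume xy: "x \<in> U" "y \<in> U"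
      then obtain b c b' c' where *: "x \<in> carrier L" "b \<in> B" "c \<in> C" "b \<sqinter> c \<sqsubseteq> x"
          "y \<in> carrier L" "b' \<in> B" "c' \<in> C" "b' \<sqinter> c' \<sqsubseteq> y"
        by (auto simp: U_def)
      then have car: "b \<in> carrier L" "c \<in> carrier L" "b' \<in> carrier L" "c' \<in> carrier L"
        using BC by auto
      have "(b \<sqinter> b') \<sqinter> (c \<sqinter> c') \<sqsubseteq> b \<sqinter> c" "(b \<sqinter> b') \<sqinter> (c \<sqinter> c') \<sqsubseteq> b' \<sqinter> c'"
        using car by (auto intro!: meet_mono meet_left meet_right)
      then have "(b \<sqinter> b') \<sqinter> (c \<sqinter> c') \<sqsubseteq> x \<sqinter> y"
        using * car by (meson le_trans meet_closed meet_le)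
      moreover have "b \<sqinter> b' \<in> B" "c \<sqinter> c' \<in> C"
        using * cf complete_filter_meet by auto
      ultimately show "x \<sqinter> y \<in> U" using * by (auto simp: U_def)
    qed
    moreover have "B \<subseteq> U" "C \<subseteq> U"
      using False BC unfolding U_def by (blast intro: meet_left meet_right)+
    ultimately have Mcl: "M \<subseteq> meet_closure L U"
      using Mleast subset_meet_closure[OF U] by blast
    have "u \<in> A \<inter> B" if u: "u \<in> A" "u \<in> U" for u
    proof -
      obtain b c where bc: "b \<in> B" "c \<in> C" "b \<sqinter> c \<sqsubseteq> u" and uc: "u \<in> carrier L"
        using u by (auto simp: U_def)
      have car: "b \<in> carrier L" "c \<in> carrier L" "{b, c} \<subseteq> carrier L" using bc BC by auto
      \<comment> \<open>The law is applied at \<open>u\<close> itself, which absorbs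
        \<open>b \<sqinter> c\<close>, so that \<open>u\<close> becomes the meet of its star
        elements.\<close>
      have "dual_star_law L u {b, c}"
        using zip uc car unfolding dually_zipper_distributive_def by (auto simp: card_insert_if)
      then have "is_glb L (u \<squnion> (b \<sqinter> c)) (star_elems L u {b, c})"
        using dual_star_law_iff[OF uc car(3)] is_glb_pair[OF car(1,2)] by blast
      moreover have "u \<squnion> (b \<sqinter> c) = u"
        using bc uc car by (metis join_comm le_iff_meet meet_closed)
      \<comment> \<open>Each star element is in \<open>A\<close>, being above \<open>u\<close>. It
        is also in \<open>B\<close> or \<open>C\<close>: by induction \<open>v\<close> lies in both,
        so \<open>d \<sqinter> v\<close> stays in whichever contains \<open>d\<close>. Then
        \<open>eq\<close> puts it in \<open>A \<inter> B\<close>.\<close>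
      moreover have "v \<in> A \<inter> B" if "v \<in> star_elems L u {b, c}" for v
        using that
      proof induction
        case (single d)
        then have d: "d \<in> B \<or> d \<in> C" "d \<in> carrier L" using bc car by auto
        have "u \<squnion> d \<in> A"
          using d u uc by (intro complete_filter_up[OF cf(1) u(1)]) (auto intro: join_left)
        moreover have "u \<squnion> d \<in> B \<or> u \<squnion> d \<in> C"
          using d uc complete_filter_up[OF cf(2)] complete_filter_up[OF cf(3)]
          by (meson join_closed join_right)
        ultimately show ?case using eq by blast
      next
        case (step v d)
        then have d: "d \<in> B \<or> d \<in> C" "d \<in> carrier L" "v \<in> B" "v \<in> C" "v \<in> carrier L"
          using bc car eq BC by auto
        have dv: "d \<sqinter> v \<in> B \<or> d \<sqinter> v \<in> C"
          using d cf complete_filter_meet by blast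
        have "u \<squnion> (d \<sqinter> v) \<in> A"
          using d u uc by (intro complete_filter_up[OF cf(1) u(1)]) (auto intro: join_left)
        moreover have "u \<squnion> (d \<sqinter> v) \<in> B \<or> u \<squnion> (d \<sqinter> v) \<in> C"
          using dv d uc complete_filter_up[OF cf(2)] complete_filter_up[OF cf(3)]
          by (meson join_closed join_right meet_closed)
        ultimately show ?case using eq by blast
      qed
      ultimately show ?thesis
        using complete_filter_glb[OF AB, of "star_elems L u {b, c}" u] by auto
    qed
    then have "A \<inter> meet_closure L U \<subseteq> A \<inter> B"
      by (intro complete_filter_meet_closure_Int[OF cf(1) AB _ U]) auto
    with Mcl show ?thesis by auto
  qed
  then have "A \<inter> B = A \<inter> M" using M by auto
  then show "A \<squnion>\<^bsub>?K\<^esub> B = A \<squnion>\<^bsub>?K\<^esub> (B \<sqinter>\<^bsub>?K\<^esub> C)"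
    using cf M by (simp add: complete_filters_join flip: M_def)
qed

lemma zipper_imp_complete_embedding:
  assumes "dually_zipper_distributive L" "lower_continuous L"
  shows "has_complete_embedding TYPE('a set) L"
  unfolding has_complete_embedding_def
  by (intro exI[of _ "complete_filters L"] exI[of _ "principal_filter L"] conjI
      complete_lattice_complete_filters lower_continuous_complete_filters
      join_semidistributive_complete_filters lattice_embedding_principal_filter
      complete_map_principal_filter assms)

end

section \<open>Closing the cycle of implications\<close>

lemma complete_imp_meet_complete_embedding:
  "has_complete_embedding TYPE('b) L \<Longrightarrow> has_meet_complete_embedding TYPE('b) L"
  unfolding has_complete_embedding_def has_meet_complete_embedding_def complete_map_def by blast

lemma has_meet_complete_embedding_imp_star:
  "lattice L \<Longrightarrow> has_meet_complete_embedding TYPE('b) L \<Longrightarrow> dually_star_distributive L"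
  unfolding has_meet_complete_embedding_def by (elim exE conjE) (rule meet_complete_embedding_imp_star)

(* The type 'b is arbitrary: the last two conjuncts say that restricting the target lattices
   to the type 'a set loses nothing, so that the first two state the equivalence for
   embeddings into lattices on any type. *)
theorem theorem11p11:
  fixes L :: "'a gorder"
  assumes "lattice L"
  shows "(has_complete_embedding TYPE('a set) L \<longleftrightarrow> has_meet_complete_embedding TYPE('a set) L) \<and>
         (has_meet_complete_embedding TYPE('a set) L \<longleftrightarrow> dually_star_distributive L) \<and>
         (dually_star_distributive L \<longleftrightarrow> dually_zipper_distributive L \<and> lower_continuous L) \<and>
         (has_complete_embedding TYPE('b) L \<longrightarrow> has_complete_embedding TYPE('a set) L) \<and>
         (has_meet_complete_embedding TYPE('b) L \<longrightarrow> has_meet_complete_embedding TYPE('a set) L)"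
  \<comment> \<open>The last two conjuncts pass through dual star-distributivity: an embedding into
    a lattice on any type \<open>'b\<close> yields it, and the complete filters then provide an
    embedding on \<open>'a set\<close>.\<close>
  by (metis lattice.zipper_imp_complete_embedding[OF assms] lattice.star_imp_lower_continuous[OF assms]
      star_imp_zipper[of L]
      complete_imp_meet_complete_embedding[where 'b = "'a set" and L = L]
      complete_imp_meet_complete_embedding[where 'b = 'b and L = L]
      has_meet_complete_embedding_imp_star[OF assms, where 'b = "'a set"]
      has_meet_complete_embedding_imp_star[OF assms, where 'b = 'b])

end
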